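(* Let $k$, $l$ and $m$ be non-negative integers, and let $\{H_1,H_2,\dots,H_m\}$ be a collection of $m$ distinct sets. If $m>\binom{k+l}{l}$ then at least one of the following two statements holds: (1) Among the $H_i$'s one can find a $(k+1)$-increasing sequence of sets $(H_{i_1},H_{i_2},\dots,H_{i_{k+2}})$. (2) Among the $H_i$'s one can find an $(l+1)$-decreasing sequence of sets $(H_{i_1},H_{i_2},\dots,H_{i_{l+2}})$.
   Context: A finite sequence of sets $(H_1,\dots,H_p)$ is called $(p-1)$-increasing if $H_1\subsetneq H_1\cup H_2\subsetneq\dots\subsetneq H_1\cup H_2\cup\dots\cup H_p$, and $(p-1)$-decreasing if $H_1\supsetneq H_1\cap H_2\supsetneq\dots\supsetneq H_1\cap H_2\cap\dots\cap H_p$. The sets $H_i$ are arbitrary (they need not be finite). *)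

theory Defs
  imports Main
begin

text \<open>
  A finite sequence \<open>(H 1, \<dots>, H (q + 1))\<close> is given by the values of a function
  \<open>H :: nat \<Rightarrow> 'a set\<close> at the indices \<open>1, \<dots>, q + 1\<close>; its other values are irrelevant.
  The number \<open>q\<close> counts the strict inclusions, so it is one less than the length.
\<close>

definition increasing_sets :: "nat \<Rightarrow> (nat \<Rightarrow> 'a set) \<Rightarrow> bool" where
  "increasing_sets q H \<longleftrightarrow> (\<forall>j\<in>{1..q}. (\<Union>i\<in>{1..j}. H i) \<subset> (\<Union>i\<in>{1..j + 1}. H i))"

definition decreasing_sets :: "nat \<Rightarrow> (nat \<Rightarrow> 'a set) \<Rightarrow> bool" where
  "decreasing_sets q H \<longleftrightarrow> (\<forall>j\<in>{1..q}. (\<Inter>i\<in>{1..j + 1}. H i) \<subset> (\<Inter>i\<in>{1..j}. H i))"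

end

theory Submission
  imports Defs
begin

text \<open>
  Pick a point \<open>x\<close> lying in some but not all of the sets, and split the family into the sets that
  contain \<open>x\<close> and those that do not. By Pascal's rule one of the two parts is still large enough
  for induction. An increasing sequence of sets missing \<open>x\<close> can be prolonged by any set containing
  \<open>x\<close>, and a decreasing sequence of sets containing \<open>x\<close> by any set missing \<open>x\<close>.
\<close>

text \<open>A sequence with \<open>q\<close> inclusions has \<open>q + 1\<close> terms, so the new
  set goes to position \<open>q + 2\<close>. The point \<open>x\<close> witnesses that the last
  inclusion is strict.\<close>

lemma increasing_sets_Suc:
  assumes inc: "increasing_sets q (\<lambda>j. H (i j))"
    and mem: "x \<in> H a" and new: "\<And>j. j \<in> i ` {1..q + 1} \<Longrightarrow> x \<notin> H j"
  shows "increasing_sets (Suc q) (\<lambda>j. H ((i(q + 2 := a)) j))"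
  unfolding increasing_sets_def
proof
  fix j assume j: "j \<in> {1..Suc q}"
  \<comment> \<open>The update at \<open>q + 2\<close> does not affect unions over the first
    \<open>q + 1\<close> positions, so the earlier inclusions carry over.\<close>
  have old: "(\<Union>t\<in>{1..n}. H ((i(q + 2 := a)) t)) = (\<Union>t\<in>{1..n}. H (i t))" if "n \<le> q + 1" for n
    using that by (intro SUP_cong) auto
  show "(\<Union>t\<in>{1..j}. H ((i(q + 2 := a)) t)) \<subset> (\<Union>t\<in>{1..j + 1}. H ((i(q + 2 := a)) t))"
  proof (cases "j \<le> q")
    case True
    then show ?thesis
      using inc j old[of j] old[of "j + 1"] by (simp add: increasing_sets_def)
  next
    case False
    with j have jq: "j = q + 1" by auto
    have "x \<notin> (\<Union>t\<in>{1..j}. H ((i(q + 2 := a)) t))"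
      using new old[of j] jq by auto
    moreover have "x \<in> (\<Union>t\<in>{1..j + 1}. H ((i(q + 2 := a)) t))"
      using mem jq by (intro UN_I[of "q + 2"]) auto
    moreover have "(\<Union>t\<in>{1..j}. H ((i(q + 2 := a)) t)) \<subseteq> (\<Union>t\<in>{1..j + 1}. H ((i(q + 2 := a)) t))"
      by (intro UN_mono) auto
    ultimately show ?thesis by blast
  qed
qed

text \<open>De Morgan: complementation reverses inclusions, so prolonging a decreasing sequence
  reduces to the increasing case.\<close>

lemma decreasing_sets_iff_increasing_sets_Compl:
  "decreasing_sets q H \<longleftrightarrow> increasing_sets q (\<lambda>j. - H j)"
proof -
  have "(\<Inter>i\<in>A. H i) \<subset> (\<Inter>i\<in>B. H i) \<longleftrightarrow> (\<Union>i\<in>B. - H i) \<subset> (\<Union>i\<in>A. - H i)" for A B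
    by blast
  then show ?thesis
    by (simp only: decreasing_sets_def increasing_sets_def)
qed

lemma decreasing_sets_Suc:
  assumes "decreasing_sets q (\<lambda>j. H (i j))"
    and "x \<notin> H a" and "\<And>j. j \<in> i ` {1..q + 1} \<Longrightarrow> x \<in> H j"
  shows "decreasing_sets (Suc q) (\<lambda>j. H ((i(q + 2 := a)) j))"
  using assms increasing_sets_Suc[of q "\<lambda>j. - H j" i x a]
  by (simp add: decreasing_sets_iff_increasing_sets_Compl)

text \<open>
  Counting strict inclusions with \<open>p = k + 1\<close> and \<open>q = l + 1\<close> makes the case of a
  one-term sequence the base of the induction.
\<close>

lemma increasing_or_decreasing_sets:
  assumes "finite I" "inj_on H I" "I \<noteq> {}"
    and "p > 0 \<Longrightarrow> q > 0 \<Longrightarrow> card I > (p + q - 2) choose (q - 1)"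
  shows "(\<exists>i. i ` {1..p + 1} \<subseteq> I \<and> increasing_sets p (\<lambda>j. H (i j))) \<or>
         (\<exists>i. i ` {1..q + 1} \<subseteq> I \<and> decreasing_sets q (\<lambda>j. H (i j)))"
  using assms
proof (induction "p + q" arbitrary: p q I rule: less_induct)
  case less
  from \<open>I \<noteq> {}\<close> obtain c where c: "c \<in> I" by blast
  show ?case
  proof (cases "p = 0 \<or> q = 0")
    case True
    \<comment> \<open>A one-term sequence has no inclusions to check, so any single index of
      \<open>I\<close> will do.\<close>
    then show ?thesis
      using c by (auto simp: increasing_sets_def decreasing_sets_def intro!: exI[of _ "\<lambda>_. c"])
  next
    case False
    then obtain k l where kl: "p = Suc k" "q = Suc l"
      by (metis not0_implies_Suc)
    have big: "card I > (k + l) choose l"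
      using less.prems(4) kl by simp
    \<comment> \<open>The binomial coefficient is at least 1. Hence there are two distinct sets, and
      some \<open>x\<close> tells them apart.\<close>
    then have "card I > 1"
      using zero_less_binomial[of l "k + l"] by linarith
    then obtain b where b: "b \<in> I" "b \<noteq> c"
      by (metis One_nat_def Suc_leI c card_le_Suc0_iff_eq leD less.prems(1))
    then have "H b \<noteq> H c"
      using c less.prems(2) by (meson inj_onD)
    then obtain x where x: "x \<in> H b \<longleftrightarrow> x \<notin> H c" by blast
    define A where "A = {j \<in> I. x \<in> H j}"
    define B where "B = {j \<in> I. x \<notin> H j}"
    have fin: "finite A" "finite B" and inj: "inj_on H A" "inj_on H B"
      using less.prems(1,2) unfolding A_def B_def by (auto intro: inj_on_subset)
    \<comment> \<open>Each part must be nonempty twice over: for the induction hypothesis, and to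
      supply the set appended to a sequence from the other part.\<close>
    have ne: "A \<noteq> {}" "B \<noteq> {}"
      using b c x unfolding A_def B_def by blast+
    have sub: "A \<subseteq> I" "B \<subseteq> I"
      unfolding A_def B_def by blast+
    have "I = A \<union> B" "A \<inter> B = {}"
      unfolding A_def B_def by blast+
    then have card: "card I = card A + card B"
      using fin by (simp add: card_Un_disjoint)
    \<comment> \<open>If both alternatives fail, then \<open>k\<close> and \<open>l\<close> are
      positive and Pascal's rule bounds \<open>card I\<close> by \<open>(k + l) choose l\<close>,
      contradicting \<open>big\<close>. The guards match those in the size hypothesis of the
      lemma.\<close>
    have "(l > 0 \<longrightarrow> card A > (k + l - 1) choose (l - 1)) \<or>
          (k > 0 \<longrightarrow> card B > (k + l - 1) choose l)"
    proof (rule ccontr)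
      assume neg: "\<not> ?thesis"
      then obtain l' where l': "l = Suc l'" by (cases l) auto
      with neg big card show False by auto
    qed
    then consider (A) "l > 0 \<Longrightarrow> card A > (k + l - 1) choose (l - 1)"
      | (B) "k > 0 \<Longrightarrow> card B > (k + l - 1) choose l"
      by blast
    then show ?thesis
    proof cases
      case A
      \<comment> \<open>Inside \<open>A\<close> only the decreasing target drops, from
        \<open>q\<close> to \<open>l\<close>; the sets there share \<open>x\<close>, so a set from
        \<open>B\<close> makes up the missing inclusion.\<close>
      have "(\<exists>i. i ` {1..p + 1} \<subseteq> A \<and> increasing_sets p (\<lambda>j. H (i j))) \<or>
            (\<exists>i. i ` {1..l + 1} \<subseteq> A \<and> decreasing_sets l (\<lambda>j. H (i j)))"
        using less.hyps[of p l A] fin(1) inj(1) ne(1) A kl by simp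
      then show ?thesis
      proof
        assume "\<exists>i. i ` {1..p + 1} \<subseteq> A \<and> increasing_sets p (\<lambda>j. H (i j))"
        then show ?thesis using sub(1) by blast
      next
        assume "\<exists>i. i ` {1..l + 1} \<subseteq> A \<and> decreasing_sets l (\<lambda>j. H (i j))"
        then obtain i where i: "i ` {1..l + 1} \<subseteq> A" "decreasing_sets l (\<lambda>j. H (i j))"
          by blast
        obtain a where a: "a \<in> B" using ne(2) by blast
        have "decreasing_sets (Suc l) (\<lambda>j. H ((i(l + 2 := a)) j))"
          using i a by (intro decreasing_sets_Suc[where x = x]) (auto simp: A_def B_def)
        moreover have "(i(l + 2 := a)) ` {1..q + 1} \<subseteq> I"
          using i(1) a sub kl by (auto simp: image_subset_iff)
        ultimately show ?thesis using kl by blast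
      qed
    next
      case B
      \<comment> \<open>Dually, inside \<open>B\<close> only the increasing target drops, from
        \<open>p\<close> to \<open>k\<close>.\<close>
      have "(\<exists>i. i ` {1..k + 1} \<subseteq> B \<and> increasing_sets k (\<lambda>j. H (i j))) \<or>
            (\<exists>i. i ` {1..q + 1} \<subseteq> B \<and> decreasing_sets q (\<lambda>j. H (i j)))"
        using less.hyps[of k q B] fin(2) inj(2) ne(2) B kl by simp
      then show ?thesis
      proof
        assume "\<exists>i. i ` {1..q + 1} \<subseteq> B \<and> decreasing_sets q (\<lambda>j. H (i j))"
        then show ?thesis using sub(2) by blast
      next
        assume "\<exists>i. i ` {1..k + 1} \<subseteq> B \<and> increasing_sets k (\<lambda>j. H (i j))"
        then obtain i where i: "i ` {1..k + 1} \<subseteq> B" "increasing_sets k (\<lambda>j. H (i j))"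
          by blast
        obtain a where a: "a \<in> A" using ne(1) by blast
        have "increasing_sets (Suc k) (\<lambda>j. H ((i(k + 2 := a)) j))"
          using i a by (intro increasing_sets_Suc[where x = x]) (auto simp: A_def B_def)
        moreover have "(i(k + 2 := a)) ` {1..p + 1} \<subseteq> I"
          using i(1) a sub kl by (auto simp: image_subset_iff)
        ultimately show ?thesis using kl by blast
      qed
    qed
  qed
qed

theorem lemma1:
  fixes k l m :: nat and H :: "nat \<Rightarrow> 'a set"
  assumes distinct: "inj_on H {1..m}"
    and large: "m > (k + l) choose l"
  shows "(\<exists>i :: nat \<Rightarrow> nat. i ` {1..k + 2} \<subseteq> {1..m} \<and> increasing_sets (k + 1) (\<lambda>j. H (i j))) \<or>
         (\<exists>i :: nat \<Rightarrow> nat. i ` {1..l + 2} \<subseteq> {1..m} \<and> decreasing_sets (l + 1) (\<lambda>j. H (i j)))"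
  \<comment> \<open>For these values the required bound is \<open>(k + l) choose l\<close>, and
    \<open>large\<close> also makes \<open>{1..m}\<close> nonempty.\<close>
  using increasing_or_decreasing_sets[of "{1..m}" H "k + 1" "l + 1"] distinct large by simp

end
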